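(* For every integer $n>1$, there are exactly $2^{\aleph_0}$ pairwise non-isomorphic biased partitions of $\mathbb{Z}^n$.
   Context: $[k]=\{1,\dots,k\}$. $\mathbb{Z}^n$ is the graph with edges $\{x,x+e_i\}$; $\Gamma(x)=\{x\pm e_i:i\in[n]\}$. A partition $\{X_i\}_{i\in[2n]}$ of $\mathbb{Z}^n$ is biased if $|\Gamma(x)\cap X_i|=1$ for every $x\in\mathbb{Z}^n$ and every $i\in[2n]$. Two biased partitions $\{X_i\}_{i\in[2n]}$ and $\{Y_i\}_{i\in[2n]}$ are isomorphic if there are a graph automorphism $\phi:\mathbb{Z}^n\to\mathbb{Z}^n$ and a permutation $\sigma$ of $[2n]$ with $\phi(X_i)=Y_{\sigma(i)}$ for all $i$. *)

theory Defs
  imports "HOL-Analysis.Finite_Cartesian_Product" "HOL-Library.Equipollence"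
    "HOL-Library.FuncSet" "HOL-Library.Disjoint_Sets" "HOL-Combinatorics.Permutations"
begin

definition lattice_edges :: "(int ^ 'n) set set"
  where "lattice_edges = {{x, x + axis i 1} | x i. True}"

definition lattice_nbrs :: "int ^ 'n \<Rightarrow> (int ^ 'n) set"
  where "lattice_nbrs x = {x + axis i 1 | i. True} \<union> {x - axis i 1 | i. True}"

lemma lattice_nbrs_iff_edge: "y \<in> lattice_nbrs x \<longleftrightarrow> {x, y} \<in> lattice_edges"
  unfolding lattice_nbrs_def lattice_edges_def
  by (auto simp: doubleton_eq_iff) (metis diff_add_cancel)

definition lattice_automorphism :: "(int ^ 'n \<Rightarrow> int ^ 'n) \<Rightarrow> bool"
  where "lattice_automorphism \<phi> \<longleftrightarrow>
    bij \<phi> \<and> (\<forall>x y. {\<phi> x, \<phi> y} \<in> lattice_edges \<longleftrightarrow> {x, y} \<in> lattice_edges)"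

definition part_index :: "'n itself \<Rightarrow> nat set"
  where "part_index _ = {1..2 * CARD('n)}"

text \<open>Families are extensional, so that a function represents exactly the family indexed
  by the set \<open>[2n]\<close>, with no information outside it.\<close>

definition biased_partition :: "(nat \<Rightarrow> (int ^ 'n) set) \<Rightarrow> bool"
  where "biased_partition X \<longleftrightarrow>
    X \<in> extensional (part_index TYPE('n)) \<and>
    (\<forall>i\<in>part_index TYPE('n). X i \<noteq> {}) \<and>
    disjoint_family_on X (part_index TYPE('n)) \<and>
    (\<Union>i\<in>part_index TYPE('n). X i) = UNIV \<and>
    (\<forall>x. \<forall>i\<in>part_index TYPE('n). card (lattice_nbrs x \<inter> X i) = 1)"

definition isomorphic_partitions ::
    "(nat \<Rightarrow> (int ^ 'n) set) \<Rightarrow> (nat \<Rightarrow> (int ^ 'n) set) \<Rightarrow> bool"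
  where "isomorphic_partitions X Y \<longleftrightarrow>
    (\<exists>\<phi> \<sigma>. lattice_automorphism \<phi> \<and> \<sigma> permutes part_index TYPE('n) \<and>
       (\<forall>i\<in>part_index TYPE('n). \<phi> ` X i = Y (\<sigma> i)))"

definition biased_partitions :: "(nat \<Rightarrow> (int ^ 'n) set) set"
  where "biased_partitions = {X. biased_partition X}"

definition partition_iso :: "((nat \<Rightarrow> (int ^ 'n) set) \<times> (nat \<Rightarrow> (int ^ 'n) set)) set"
  where "partition_iso =
    {(X, Y). X \<in> biased_partitions \<and> Y \<in> biased_partitions \<and> isomorphic_partitions X Y}"

lemma lattice_automorphism_id: "lattice_automorphism id"
  by (simp add: lattice_automorphism_def)

lemma lattice_automorphism_inv:
  assumes "lattice_automorphism \<phi>"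
  shows "lattice_automorphism (inv \<phi>)"
proof -
  have b: "bij \<phi>" and e: "\<And>x y. {\<phi> x, \<phi> y} \<in> lattice_edges \<longleftrightarrow> {x, y} \<in> lattice_edges"
    using assms by (auto simp: lattice_automorphism_def)
  have "{inv \<phi> x, inv \<phi> y} \<in> lattice_edges \<longleftrightarrow> {x, y} \<in> lattice_edges" for x y
    using e[of "inv \<phi> x" "inv \<phi> y"] b by (simp add: bij_is_surj surj_f_inv_f)
  then show ?thesis
    using b by (simp add: lattice_automorphism_def bij_imp_bij_inv)
qed

lemma lattice_automorphism_comp:
  "lattice_automorphism \<phi> \<Longrightarrow> lattice_automorphism \<psi> \<Longrightarrow> lattice_automorphism (\<psi> \<circ> \<phi>)"
  by (auto simp: lattice_automorphism_def intro: bij_comp)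

lemma isomorphic_partitions_refl: "isomorphic_partitions X X"
  unfolding isomorphic_partitions_def
  using lattice_automorphism_id permutes_id by fastforce

lemma isomorphic_partitions_sym:
  fixes X Y :: "nat \<Rightarrow> (int ^ 'n) set"
  assumes "isomorphic_partitions X Y"
  shows "isomorphic_partitions Y X"
proof -
  obtain \<phi> \<sigma> where a: "lattice_automorphism \<phi>" and s: "\<sigma> permutes part_index TYPE('n)"
    and eq: "\<And>i. i \<in> part_index TYPE('n) \<Longrightarrow> \<phi> ` X i = Y (\<sigma> i)"
    using assms unfolding isomorphic_partitions_def by blast
  have inj: "inj \<phi>"
    using a by (simp add: lattice_automorphism_def bij_is_inj)
  have "inv \<phi> ` Y i = X (inv \<sigma> i)" if i: "i \<in> part_index TYPE('n)" for i
  proof -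
    have "inv \<sigma> i \<in> part_index TYPE('n)"
      using i s by (meson permutes_in_image permutes_inv)
    then have "\<phi> ` X (inv \<sigma> i) = Y i"
      using eq s by (simp add: permutes_inverses)
    then show ?thesis
      using inj by (metis image_inv_f_f)
  qed
  then show ?thesis
    unfolding isomorphic_partitions_def
    using lattice_automorphism_inv[OF a] permutes_inv[OF s] by blast
qed

lemma isomorphic_partitions_trans:
  fixes X Y Z :: "nat \<Rightarrow> (int ^ 'n) set"
  assumes "isomorphic_partitions X Y" "isomorphic_partitions Y Z"
  shows "isomorphic_partitions X Z"
proof -
  obtain \<phi> \<sigma> where 1: "lattice_automorphism \<phi>" "\<sigma> permutes part_index TYPE('n)"
    "\<And>i. i \<in> part_index TYPE('n) \<Longrightarrow> \<phi> ` X i = Y (\<sigma> i)"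
    using assms(1) unfolding isomorphic_partitions_def by blast
  obtain \<psi> \<tau> where 2: "lattice_automorphism \<psi>" "\<tau> permutes part_index TYPE('n)"
    "\<And>i. i \<in> part_index TYPE('n) \<Longrightarrow> \<psi> ` Y i = Z (\<tau> i)"
    using assms(2) unfolding isomorphic_partitions_def by blast
  have "(\<psi> \<circ> \<phi>) ` X i = Z ((\<tau> \<circ> \<sigma>) i)" if "i \<in> part_index TYPE('n)" for i
  proof -
    have "\<sigma> i \<in> part_index TYPE('n)"
      using that 1(2) by (simp add: permutes_in_image)
    then show ?thesis
      using 1(3)[OF that] 2(3) by (metis comp_apply image_comp)
  qed
  then show ?thesis
    unfolding isomorphic_partitions_def
    using lattice_automorphism_comp[OF 1(1) 2(1)] permutes_compose[OF 1(2) 2(2)] by blast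
qed

lemma equiv_partition_iso: "equiv biased_partitions partition_iso"
  by (rule equivI)
    (auto simp: partition_iso_def refl_on_def sym_def trans_def
      intro: isomorphic_partitions_refl isomorphic_partitions_sym isomorphic_partitions_trans)

end

theory Submission
  imports Defs
begin

text \<open>Write \<open>f(x) = x\<^sub>1 + 3 x\<^sub>2 + \<dots> + (2n - 1) x\<^sub>n\<close>. On the neighbours of \<open>x\<close>, \<open>f\<close> takes every residue modulo
  \<open>4n\<close> of parity opposite to \<open>f(x)\<close> exactly once, so merging the residues \<open>2k\<close> and \<open>2k + 1\<close> gives a
  biased partition. The neighbours of \<open>x\<close> whose \<open>f\<close>-values differ by \<open>2n\<close> lie on the same level set of
  \<open>x\<^sub>1 - x\<^sub>n\<close>; hence \<open>2n\<close> may be added to \<open>f\<close> on an arbitrary collection of level sets, and this yields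
  \<open>2\<close> to the \<open>\<aleph>\<^sub>0\<close> biased partitions. An automorphism of the lattice is determined by its values on
  the unit ball around \<open>0\<close>, so there are only countably many of them, and every isomorphism class is
  countable.\<close>

section \<open>Unit vectors and neighbourhoods in the lattice\<close>

definition lattice_units :: "(int ^ 'n) set"
  where "lattice_units = {axis i s | i s. \<bar>s\<bar> = 1}"

lemma axis_in_lattice_units: "\<bar>s\<bar> = 1 \<Longrightarrow> axis i s \<in> lattice_units"
  unfolding lattice_units_def by blast

lemma lattice_nbrs_eq:
  fixes x y :: "int ^ 'n"
  shows "y \<in> lattice_nbrs x \<longleftrightarrow> y - x \<in> lattice_units"
proof -
  have *: "x - axis i 1 - x = axis i (-1)" for i and x :: "int ^ 'n"
    by (simp add: vec_eq_iff axis_def)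
  have "y \<in> lattice_nbrs x" if "y - x = axis i s" "\<bar>s\<bar> = 1" for i s
  proof -
    have "s = 1 \<or> s = -1" using that(2) by linarith
    moreover have "y = x + axis i s" using that(1) by (metis add.commute diff_add_cancel)
    moreover have "x + axis i (-1) = x - axis i 1" by (simp add: vec_eq_iff axis_def)
    ultimately show ?thesis unfolding lattice_nbrs_def by auto
  qed
  then show ?thesis
    unfolding lattice_nbrs_def lattice_units_def by (fastforce simp: *)
qed

lemma lattice_nbrs_plus_iff [simp]: "x + a \<in> lattice_nbrs x \<longleftrightarrow> a \<in> lattice_units"
  by (simp add: lattice_nbrs_eq)

lemma lattice_nbrsE:
  assumes "y \<in> lattice_nbrs x"
  obtains a where "a \<in> lattice_units" "y = x + a"
  using that[of "y - x"] assms by (simp add: lattice_nbrs_eq)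

lemma lattice_units_uminus:
  fixes a :: "int ^ 'n"
  assumes "a \<in> lattice_units"
  shows "- a \<in> lattice_units"
proof -
  obtain i s where "a = axis i s" "\<bar>s\<bar> = 1" using assms unfolding lattice_units_def by blast
  moreover have "- axis i s = (axis i (- s) :: int ^ 'n)"
    by (simp add: vec_eq_iff axis_def)
  ultimately show ?thesis using axis_in_lattice_units[of "- s" i] by simp
qed

lemma finite_lattice_nbrs: "finite (lattice_nbrs x)"
  and card_lattice_nbrs_le: "card (lattice_nbrs (x :: int ^ 'n)) \<le> 2 * CARD('n)"
proof -
  have eq: "lattice_nbrs x = range (\<lambda>i. x + axis i 1) \<union> range (\<lambda>i. x - axis i 1)"
    unfolding lattice_nbrs_def by auto
  then show "finite (lattice_nbrs x)" by simp
  have "card (lattice_nbrs x) \<le> card (range (\<lambda>i. x + axis i 1)) + card (range (\<lambda>i. x - axis i 1))"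
    unfolding eq by (rule card_Un_le)
  also have "\<dots> \<le> CARD('n) + CARD('n)"
    by (intro add_mono card_image_le) simp_all
  finally show "card (lattice_nbrs x) \<le> 2 * CARD('n)" by simp
qed

lemma lattice_units_nth_bound: "a \<in> lattice_units \<Longrightarrow> \<bar>a $ i\<bar> \<le> 1"
  unfolding lattice_units_def by (auto simp: axis_def)

lemma lattice_units_eqI:
  assumes "a \<in> lattice_units" "b \<in> lattice_units" "a $ i = b $ i" "a $ i \<noteq> 0"
  shows "a = b"
proof -
  have "c = axis i (c $ i)" if "c \<in> lattice_units" "c $ i \<noteq> 0" for c
    using that unfolding lattice_units_def by (auto simp: vec_eq_iff axis_def split: if_splits)
  then show ?thesis using assms by metis
qed

text \<open>Compare the coordinate that supports \<open>a\<close>, where \<open>a\<close> has the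
  value \<open>s\<close>. There the left side is \<open>s\<close> or \<open>2 * s\<close>, as
  \<open>c\<close> is not \<open>- a\<close>, while \<open>b\<close> does not contribute
  \<open>s\<close>; so \<open>d\<close> has to be \<open>a\<close>. Geometrically, a 4-cycle of the
  lattice is a parallelogram.\<close>

lemma lattice_units_add_eq:
  assumes units: "a \<in> lattice_units" "b \<in> lattice_units" "c \<in> lattice_units" "d \<in> lattice_units"
    and eq: "a + c = b + d" and "a \<noteq> b" "c \<noteq> - a"
  shows "c = b"
proof -
  obtain i s where a: "a = axis i s" "\<bar>s\<bar> = 1"
    using units(1) unfolding lattice_units_def by blast
  have ai: "a $ i = s" using a by simp
  have eqi: "s + c $ i = b $ i + d $ i" using arg_cong[OF eq, of "\<lambda>v. v $ i"] ai by simp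
  have "b $ i \<noteq> s" using lattice_units_eqI[OF units(1,2), of i] ai a(2) \<open>a \<noteq> b\<close> by fastforce
  moreover have "c $ i \<noteq> - s"
    using lattice_units_eqI[OF units(3) lattice_units_uminus[OF units(1)], of i] ai a(2) \<open>c \<noteq> - a\<close>
    by fastforce
  ultimately have "d $ i = s"
    using eqi a(2) lattice_units_nth_bound[OF units(2), of i] lattice_units_nth_bound[OF units(3), of i]
      lattice_units_nth_bound[OF units(4), of i] by linarith
  then have "d = a" using lattice_units_eqI[OF units(4,1), of i] ai a(2) by fastforce
  then show ?thesis using eq by simp
qed

section \<open>Rigidity of lattice automorphisms\<close>

lemma lattice_automorphism_nbrs_iff:
  "lattice_automorphism \<phi> \<Longrightarrow> \<phi> y \<in> lattice_nbrs (\<phi> x) \<longleftrightarrow> y \<in> lattice_nbrs x"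
  by (simp add: lattice_automorphism_def lattice_nbrs_iff_edge)

text \<open>The image of the square on \<open>x\<close>, \<open>x + a\<close>,
  \<open>x + a + b\<close>, \<open>x + b\<close> is a 4-cycle with distinct corners by injectivity,
  hence a parallelogram by \<open>lattice_units_add_eq\<close>.\<close>

lemma lattice_automorphism_square:
  assumes \<phi>: "lattice_automorphism \<phi>" and units: "a \<in> lattice_units" "b \<in> lattice_units"
    and ne: "b \<noteq> a" "b \<noteq> - a"
  shows "\<phi> (x + a + b) = \<phi> (x + a) + \<phi> (x + b) - \<phi> x"
proof -
  have inj: "inj \<phi>" using \<phi> by (simp add: lattice_automorphism_def bij_is_inj)
  have "x + b + a \<in> lattice_nbrs (x + b)" "x + a + b \<in> lattice_nbrs (x + a)"
    "x + a \<in> lattice_nbrs x" "x + b \<in> lattice_nbrs x"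
    using units by simp_all
  then have n: "\<phi> (x + a + b) \<in> lattice_nbrs (\<phi> (x + b))" "\<phi> (x + a + b) \<in> lattice_nbrs (\<phi> (x + a))"
    "\<phi> (x + a) \<in> lattice_nbrs (\<phi> x)" "\<phi> (x + b) \<in> lattice_nbrs (\<phi> x)"
    using lattice_automorphism_nbrs_iff[OF \<phi>] by (simp_all add: add.assoc add.commute[of a b])
  have "\<phi> (x + a + b) - \<phi> (x + a) = \<phi> (x + b) - \<phi> x"
  proof (rule lattice_units_add_eq)
    show "\<phi> (x + a) - \<phi> x \<in> lattice_units" "\<phi> (x + b) - \<phi> x \<in> lattice_units"
      "\<phi> (x + a + b) - \<phi> (x + a) \<in> lattice_units" "\<phi> (x + a + b) - \<phi> (x + b) \<in> lattice_units"
      using n by (simp_all add: lattice_nbrs_eq)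
    show "\<phi> (x + a) - \<phi> x \<noteq> \<phi> (x + b) - \<phi> x"
      using ne by (simp add: inj_eq[OF inj])
    have "a + b \<noteq> 0" using ne by (simp add: add_eq_0_iff)
    then have "x + a + b \<noteq> x" by (simp add: add.assoc)
    then have "\<phi> (x + a + b) \<noteq> \<phi> x" by (simp only: inj_eq[OF inj] not_False_eq_True)
    then show "\<phi> (x + a + b) - \<phi> (x + a) \<noteq> - (\<phi> (x + a) - \<phi> x)" by auto
  qed auto
  then show ?thesis by (simp add: algebra_simps)
qed

text \<open>Apart from \<open>x\<close> itself, every neighbour of \<open>x + a\<close> other than
  \<open>x + a + a\<close> is the fourth corner of a square whose other corners lie in the unit ball
  around \<open>x\<close>. Bijectivity then leaves a single value for
  \<open>x + a + a\<close>.\<close>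

lemma lattice_automorphism_agree_step:
  assumes \<phi>: "lattice_automorphism \<phi>" and \<psi>: "lattice_automorphism \<psi>"
    and agree: "\<And>y. y \<in> insert x (lattice_nbrs x) \<Longrightarrow> \<phi> y = \<psi> y"
    and a: "a \<in> lattice_units" and y: "y \<in> insert (x + a) (lattice_nbrs (x + a))"
  shows "\<phi> y = \<psi> y"
proof -
  have xa: "\<phi> (x + a) = \<psi> (x + a)" and x: "\<phi> x = \<psi> x" using agree a by simp_all
  have other: "\<phi> (x + a + b) = \<psi> (x + a + b)" if b: "b \<in> lattice_units" "b \<noteq> a" for b
  proof (cases "b = - a")
    case True
    then show ?thesis using x by simp
  next
    case False
    then show ?thesis
      using lattice_automorphism_square[OF \<phi> a b(1) b(2)] lattice_automorphism_square[OF \<psi> a b(1) b(2)]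
        agree[of "x + b"] b xa x by simp
  qed
  \<comment> \<open>Were the \<phi>-preimage \<open>w\<close> of \<open>\<psi> (x + a + a)\<close>
    another neighbour of \<open>x + a\<close>, both maps would agree at \<open>w\<close>, and
    injectivity of \<psi> would give \<open>w = x + a + a\<close>.\<close>
  have straight: "\<phi> (x + a + a) = \<psi> (x + a + a)"
  proof -
    have "surj \<phi>" using \<phi> by (simp add: lattice_automorphism_def bij_is_surj)
    then obtain w where w: "\<psi> (x + a + a) = \<phi> w" by (meson surjD)
    have "\<psi> (x + a + a) \<in> lattice_nbrs (\<psi> (x + a))"
      using lattice_automorphism_nbrs_iff[OF \<psi>] a by (metis lattice_nbrs_plus_iff)
    then have "w \<in> lattice_nbrs (x + a)"
      using lattice_automorphism_nbrs_iff[OF \<phi>] w xa by metis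
    then obtain b where b: "b \<in> lattice_units" "w = x + a + b"
      by (rule lattice_nbrsE)
    show ?thesis
    proof (cases "b = a")
      case False
      then have "\<psi> (x + a + a) = \<psi> w" using w other b by simp
      then have "x + a + a = w"
        using \<psi> by (meson lattice_automorphism_def bij_is_inj injD)
      then show ?thesis using b False by simp
    qed (use w b in simp)
  qed
  show ?thesis
  proof (cases "y = x + a")
    case False
    with y have "y \<in> lattice_nbrs (x + a)" by simp
    then obtain b where "b \<in> lattice_units" "y = x + a + b"
      by (rule lattice_nbrsE)
    then show ?thesis using other straight by metis
  qed (use xa in simp)
qed

text \<open>This is connectedness of the lattice: the coordinates are filled in one at a time, each
  by a walk along its axis.\<close>

lemma lattice_induct:
  fixes x :: "int ^ 'n"
  assumes 0: "P 0" and step: "\<And>x a. P x \<Longrightarrow> a \<in> lattice_units \<Longrightarrow> P (x + a)"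
  shows "P x"
proof -
  have line: "P (y + axis i k)" if "P y" for y i k
  proof (induction k rule: int_induct[where k = 0])
    case base
    have "y + axis i 0 = y" by (simp add: vec_eq_iff axis_def)
    then show ?case using that by metis
  next
    case (step1 k)
    have "y + axis i (k + 1) = y + axis i k + axis i 1" by (simp add: vec_eq_iff axis_def)
    then show ?case
      using step[OF step1(2) axis_in_lattice_units[of 1 i]] by (metis abs_one)
  next
    case (step2 k)
    have "y + axis i (k - 1) = y + axis i k + axis i (-1)" by (simp add: vec_eq_iff axis_def)
    then show ?case
      using step[OF step2(2) axis_in_lattice_units[of "-1" i]] by (metis abs_minus_cancel abs_one)
  qed
  have "P (\<Sum>i\<in>A. axis i (x $ i))" if "finite A" for A
    using that by induction (simp_all add: 0 line add.commute[of "axis _ _"])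
  then have "P (\<Sum>i\<in>UNIV. axis i (x $ i))" by simp
  moreover have "(\<Sum>i\<in>UNIV. axis i (x $ i)) = x"
    by (simp add: vec_eq_iff axis_def)
  ultimately show ?thesis by simp
qed

lemma lattice_automorphism_eqI:
  assumes \<phi>: "lattice_automorphism \<phi>" and \<psi>: "lattice_automorphism \<psi>"
    and agree: "\<And>y. y \<in> insert 0 (lattice_nbrs 0) \<Longrightarrow> \<phi> y = \<psi> y"
  shows "\<phi> = \<psi>"
proof
  fix x
  \<comment> \<open>The induction carries agreement on the whole unit ball, since agreement at one
    point does not propagate.\<close>
  have "\<forall>y\<in>insert x (lattice_nbrs x). \<phi> y = \<psi> y"
  proof (induction x rule: lattice_induct)
    case (2 x a)
    then show ?case using lattice_automorphism_agree_step[OF \<phi> \<psi>, of x a] by blast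
  qed (use agree in blast)
  then show "\<phi> x = \<psi> x" by simp
qed

section \<open>Countability of the isomorphism classes\<close>

lemma countable_lattice_automorphisms:
  "countable {\<phi> :: int ^ 'n \<Rightarrow> int ^ 'n. lattice_automorphism \<phi>}"
proof -
  let ?B = "insert 0 (lattice_nbrs 0) :: (int ^ 'n) set"
  have "inj_on (\<lambda>\<phi>. restrict \<phi> ?B) {\<phi>. lattice_automorphism \<phi>}"
    by (intro inj_onI lattice_automorphism_eqI) (auto, (metis restrict_apply' insertCI)+)
  moreover have "countable (?B \<rightarrow>\<^sub>E (UNIV :: (int ^ 'n) set))"
    by (rule countable_PiE) (auto simp: finite_lattice_nbrs)
  then have "countable ((\<lambda>\<phi>. restrict \<phi> ?B) ` {\<phi>. lattice_automorphism \<phi>})"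
    by (rule countable_subset[rotated]) (intro image_subsetI, subst restrict_PiE_iff, simp)
  ultimately show ?thesis
    using countable_image_inj_on by blast
qed

text \<open>The witnesses \<phi> and \<sigma> determine the isomorphic partition: its part
  \<open>i\<close> is the \<phi>-image of the part \<open>inv \<sigma> i\<close> of
  \<open>X\<close>, and extensionality fixes the values outside the index set.\<close>

lemma countable_partition_iso_class:
  fixes X :: "nat \<Rightarrow> (int ^ 'n) set"
  shows "countable (partition_iso `` {X})"
proof -
  let ?I = "part_index TYPE('n)"
  let ?K = "{\<phi> :: int ^ 'n \<Rightarrow> int ^ 'n. lattice_automorphism \<phi>} \<times> {\<sigma>. \<sigma> permutes ?I}"
  let ?g = "\<lambda>(\<phi> :: int ^ 'n \<Rightarrow> int ^ 'n, \<sigma>). \<lambda>i\<in>?I. \<phi> ` X (inv \<sigma> i)"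
  have "countable ?K"
    by (intro countable_SIGMA countable_lattice_automorphisms countable_finite finite_permutations)
      (simp add: part_index_def)
  moreover have "partition_iso `` {X} \<subseteq> ?g ` ?K"
  proof
    fix Y assume "Y \<in> partition_iso `` {X}"
    then obtain \<phi> \<sigma> where Y: "Y \<in> extensional ?I" and \<phi>: "lattice_automorphism \<phi>"
      and \<sigma>: "\<sigma> permutes ?I" and eq: "\<And>i. i \<in> ?I \<Longrightarrow> \<phi> ` X i = Y (\<sigma> i)"
      by (auto simp: partition_iso_def biased_partitions_def biased_partition_def
          isomorphic_partitions_def)
    have "Y = ?g (\<phi>, \<sigma>)"
    proof
      fix i
      show "Y i = ?g (\<phi>, \<sigma>) i"
      proof (cases "i \<in> ?I")
        case True
        then have "inv \<sigma> i \<in> ?I" using \<sigma> by (meson permutes_in_image permutes_inv)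
        then show ?thesis using eq[of "inv \<sigma> i"] True \<sigma> by (simp add: permutes_inverses)
      qed (use Y in \<open>simp add: extensional_def\<close>)
    qed
    then show "Y \<in> ?g ` ?K" using \<phi> \<sigma> by blast
  qed
  ultimately show ?thesis by (meson countable_image countable_subset)
qed

text \<open>A partition is recovered from its set of pairs of an index and a point in that part, a
  subset of a countable type.\<close>

lemma biased_partitions_lepoll:
  "(biased_partitions :: (nat \<Rightarrow> (int ^ 'n) set) set) \<lesssim> (UNIV :: nat set set)"
proof -
  let ?I = "part_index TYPE('n)"
  let ?g = "\<lambda>X :: nat \<Rightarrow> (int ^ 'n) set. to_nat ` (SIGMA i:?I. X i)"
  have "inj_on ?g biased_partitions"
  proof (rule inj_onI)
    fix X Y :: "nat \<Rightarrow> (int ^ 'n) set"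
    assume XY: "X \<in> biased_partitions" "Y \<in> biased_partitions" and "?g X = ?g Y"
    then have eq: "(SIGMA i:?I. X i) = (SIGMA i:?I. Y i)"
      by (simp add: inj_image_eq_iff)
    show "X = Y"
    proof (rule extensionalityI)
      show "X \<in> extensional ?I" "Y \<in> extensional ?I"
        using XY by (auto simp: biased_partitions_def biased_partition_def)
      show "X i = Y i" if "i \<in> ?I" for i
        using that eq by blast
    qed
  qed
  then show ?thesis unfolding lepoll_def by blast
qed

section \<open>Biased partitions from shifted weight colourings\<close>

text \<open>A point has at most \<open>2n\<close> neighbours, so if they show all \<open>2n\<close>
  colours, each colour occurs exactly once.\<close>

lemma biased_partition_of_colouring:
  fixes c :: "int ^ 'n \<Rightarrow> nat"
  assumes range: "\<And>x. c x \<in> part_index TYPE('n)"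
    and surj: "\<And>x i. i \<in> part_index TYPE('n) \<Longrightarrow> \<exists>y\<in>lattice_nbrs x. c y = i"
  shows "biased_partition (\<lambda>i\<in>part_index TYPE('n). {x. c x = i})"
proof -
  let ?I = "part_index TYPE('n)"
  have "card (lattice_nbrs x \<inter> {y. c y = i}) = 1" if i: "i \<in> ?I" for x i
  proof -
    have "c ` lattice_nbrs x = ?I" using range surj by blast
    then have "card (lattice_nbrs x) \<le> card (c ` lattice_nbrs x)"
      using card_lattice_nbrs_le[of x] by (simp add: part_index_def)
    then have inj: "inj_on c (lattice_nbrs x)"
      by (meson card_image_le eq_card_imp_inj_on finite_lattice_nbrs le_antisym)
    obtain y where y: "y \<in> lattice_nbrs x" "c y = i" using surj[OF i] by blast
    then have "lattice_nbrs x \<inter> {y. c y = i} = {y}"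
      using inj by (auto dest: inj_onD)
    then show ?thesis by simp
  qed
  moreover have "{x. c x = i} \<noteq> {}" if "i \<in> ?I" for i
    using surj[OF that] by blast
  ultimately show ?thesis
    unfolding biased_partition_def disjoint_family_on_def using range by auto
qed

lemma odd_mod_4n_cases:
  fixes m :: int and n :: nat
  assumes "odd m" "n > 0"
  obtains \<epsilon> k where "\<bar>\<epsilon>\<bar> = 1" "k < n" "(4 * int n) dvd (m - \<epsilon> * (2 * int k + 1))"
proof -
  define r where "r = m mod (4 * int n)"
  have r: "0 \<le> r" "r < 4 * int n" using assms(2) by (simp_all add: r_def)
  have d: "(4 * int n) dvd (m - r)" by (simp add: r_def mod_eq_dvd_iff)
  then have "even (m - r)" by (meson dvd_trans dvd_triv_left even_mult_iff even_numeral)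
  then have "odd r" using assms(1) by simp
  then obtain j where j: "r = 2 * j + 1" by (rule oddE)
  show thesis
  proof (cases "j < int n")
    case True
    then show thesis using that[of 1 "nat j"] d j r by simp
  next
    case False
    \<comment> \<open>The residue \<open>2 * j + 1\<close> exceeds \<open>2n\<close> here, and its
      complement to \<open>4n\<close> is \<open>2 * k + 1\<close>.\<close>
    define k where "k = nat (2 * int n - 1 - j)"
    have k: "int k = 2 * int n - 1 - j" using j r by (simp add: k_def)
    then have "m - (- 1) * (2 * int k + 1) = m - r + 4 * int n" using j by simp
    moreover have "(4 * int n) dvd (m - r + 4 * int n)" using d by simp
    ultimately have "(4 * int n) dvd (m - (- 1) * (2 * int k + 1))" by metis
    moreover have "k < n" using k False by linarith
    ultimately show thesis using that[of "-1" k] by linarith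
  qed
qed

context
  fixes h :: "'n::finite \<Rightarrow> nat"
  assumes h: "bij_betw h UNIV {..<CARD('n)}"
begin

text \<open>The bijection \<open>h\<close> labels the coordinates by \<open>0\<close> to
  \<open>n - 1\<close>, so the coefficients run through \<open>1, 3, ..., 2n - 1\<close>.\<close>

definition weight :: "int ^ 'n \<Rightarrow> int"
  where "weight x = (\<Sum>i\<in>UNIV. (2 * int (h i) + 1) * x $ i)"

definition level :: "int ^ 'n \<Rightarrow> int"
  where "level x = x $ (inv h 0) - x $ (inv h (CARD('n) - 1))"

text \<open>Halving merges the residues \<open>2k\<close> and \<open>2k + 1\<close>, and
  \<open>Suc\<close> makes the colours start at 1. Only nonnegative levels are ever shifted, which
  lets sets of naturals index the family.\<close>

definition colour :: "nat set \<Rightarrow> int ^ 'n \<Rightarrow> nat"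
  where "colour S x = Suc (nat ((weight x + (if level x \<in> int ` S then 2 * int CARD('n) else 0))
    mod (4 * int CARD('n)) div 2))"

lemma h_inv: "k < CARD('n) \<Longrightarrow> h (inv h k) = k"
  using h by (auto simp: bij_betw_def f_inv_into_f)

lemma inv_h_eq_iff: "k < CARD('n) \<Longrightarrow> l < CARD('n) \<Longrightarrow> inv h k = inv h l \<longleftrightarrow> k = l"
  by (metis h_inv)

lemma weight_add_axis: "weight (x + axis i s) = weight x + (2 * int (h i) + 1) * s"
proof -
  have "weight (x + axis i s)
      = weight x + (\<Sum>j\<in>UNIV. if j = i then (2 * int (h i) + 1) * s else 0)"
    unfolding weight_def sum.distrib[symmetric]
    by (rule sum.cong) (auto simp: axis_def algebra_simps)
  then show ?thesis by simp
qed

lemma level_add_axis: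
  "level (x + axis i s) = level x + (if inv h 0 = i then s else 0)
    - (if inv h (CARD('n) - 1) = i then s else 0)"
  by (simp add: level_def axis_def)

text \<open>Replacing the label \<open>k\<close> of a unit vector by \<open>n - 1 - k\<close> and reversing its sign shifts its
  weight by \<open>2n\<close> modulo \<open>4n\<close>. It preserves the level, because it exchanges the labels \<open>0\<close>
  and \<open>n - 1\<close>, on which the level depends with opposite signs.\<close>
lemma antipodal_nbrs:
  fixes x :: "int ^ 'n"
  assumes "odd m"
  obtains y z where "y \<in> lattice_nbrs x" "z \<in> lattice_nbrs x" "level y = level z"
    "(4 * int CARD('n)) dvd (weight y - (weight x + m))"
    "(4 * int CARD('n)) dvd (weight z - (weight x + m + 2 * int CARD('n)))"
proof -
  let ?n = "CARD('n)"
  have n: "?n > 0" by simp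
  obtain \<epsilon> k where e: "\<bar>\<epsilon>\<bar> = 1" and k: "k < ?n" and dv: "(4 * int ?n) dvd (m - \<epsilon> * (2 * int k + 1))"
    using odd_mod_4n_cases[OF assms n] by metis
  define i where "i = inv h k"
  define j where "j = inv h (?n - 1 - k)"
  have hi: "h i = k" and hj: "h j = ?n - 1 - k"
    using k n by (simp_all add: i_def j_def h_inv)
  define y where "y = x + axis i \<epsilon>"
  define z where "z = x + axis j (- \<epsilon>)"
  show thesis
  proof
    show "y \<in> lattice_nbrs x" "z \<in> lattice_nbrs x"
      using e by (simp_all add: y_def z_def axis_in_lattice_units)
    have "0 = ?n - 1 - k \<longleftrightarrow> k = ?n - 1" "?n - 1 = ?n - 1 - k \<longleftrightarrow> k = 0"
      using k by arith+
    moreover have "inv h 0 = i \<longleftrightarrow> 0 = k" "inv h 0 = j \<longleftrightarrow> 0 = ?n - 1 - k"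
      "inv h (?n - 1) = i \<longleftrightarrow> ?n - 1 = k" "inv h (?n - 1) = j \<longleftrightarrow> ?n - 1 = ?n - 1 - k"
      unfolding i_def j_def by (rule inv_h_eq_iff; use k n in linarith)+
    ultimately have eqs: "inv h 0 = i \<longleftrightarrow> k = 0" "inv h 0 = j \<longleftrightarrow> k = ?n - 1"
      "inv h (?n - 1) = i \<longleftrightarrow> k = ?n - 1" "inv h (?n - 1) = j \<longleftrightarrow> k = 0"
      by metis+
    show "level y = level z"
      unfolding y_def z_def level_add_axis eqs by simp
    have "weight y - (weight x + m) = - (m - \<epsilon> * (2 * int k + 1))"
      by (simp add: y_def weight_add_axis hi)
    then show "(4 * int ?n) dvd (weight y - (weight x + m))"
      using dv by (metis dvd_minus_iff)
    have "int (?n - 1 - k) = int ?n - 1 - int k" using k by simp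
    then have "weight z - (weight x + m + 2 * int ?n)
        = - (m - \<epsilon> * (2 * int k + 1)) - 2 * int ?n * (\<epsilon> + 1)"
      by (simp add: z_def weight_add_axis hj algebra_simps)
    \<comment> \<open>The factor \<open>\<epsilon> + 1\<close> is 0 or 2.\<close>
    moreover have "(4 * int ?n) dvd (2 * int ?n * (\<epsilon> + 1))"
      using e by (auto simp: abs_if split: if_splits)
    ultimately show "(4 * int ?n) dvd (weight z - (weight x + m + 2 * int ?n))"
      using dv by (metis dvd_diff dvd_minus_iff)
  qed
qed

lemma colour_eqI:
  assumes "(4 * int CARD('n)) dvd
      (weight x + (if level x \<in> int ` S then 2 * int CARD('n) else 0) - int r)"
    and "r < 4 * CARD('n)"
  shows "colour S x = Suc (r div 2)"
proof -
  have "(weight x + (if level x \<in> int ` S then 2 * int CARD('n) else 0)) mod (4 * int CARD('n))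
      = int r mod (4 * int CARD('n))"
    using assms(1) by (simp add: mod_eq_dvd_iff)
  also have "\<dots> = int r" using assms(2) by simp
  finally show ?thesis unfolding colour_def by (simp add: nat_div_distrib)
qed

lemma colour_in_part_index: "colour S x \<in> part_index TYPE('n)"
proof -
  let ?N = "4 * int CARD('n)"
  define r where "r = (weight x + (if level x \<in> int ` S then 2 * int CARD('n) else 0)) mod ?N"
  have "0 \<le> r" "r < ?N" by (simp_all add: r_def)
  then show ?thesis unfolding colour_def r_def[symmetric] part_index_def by auto
qed

text \<open>The antipodal neighbours \<open>y\<close> and \<open>z\<close> are shifted together.
  Unshifted, \<open>y\<close> has the wanted residue \<open>r\<close>; shifted, \<open>z\<close> has
  it, as \<open>r + 2n + 2n\<close> is \<open>r\<close> modulo \<open>4n\<close>.\<close>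

lemma colour_surj_on_nbrs:
  assumes "i \<in> part_index TYPE('n)"
  shows "\<exists>y\<in>lattice_nbrs x. colour S y = i"
proof -
  let ?n = "CARD('n)"
  \<comment> \<open>Of the two residues with colour \<open>i\<close>, this is the one of parity
    opposite to \<open>weight x\<close>.\<close>
  define r where "r = 2 * (i - 1) + (if even (weight x) then 1 else 0)"
  have r: "r < 4 * ?n" "Suc (r div 2) = i" and "odd (int r - weight x)"
    using assms by (auto simp: r_def part_index_def)
  then obtain y z where yz: "y \<in> lattice_nbrs x" "z \<in> lattice_nbrs x" "level y = level z"
    and y: "(4 * int ?n) dvd (weight y - int r)"
    and z: "(4 * int ?n) dvd (weight z - (int r + 2 * int ?n))"
    using antipodal_nbrs[of "int r - weight x" x] by (auto simp: algebra_simps)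
  show ?thesis
  proof (cases "level y \<in> int ` S")
    case True
    have "weight z + 2 * int ?n - int r = weight z - (int r + 2 * int ?n) + 4 * int ?n" by simp
    then have "(4 * int ?n) dvd (weight z + 2 * int ?n - int r)"
      using z by (metis dvd_add dvd_refl)
    then have "colour S z = Suc (r div 2)"
      using True yz(3) r(1) by (intro colour_eqI) auto
    then show ?thesis using r yz by auto
  next
    case False
    then have "colour S y = Suc (r div 2)"
      using y r(1) by (intro colour_eqI) auto
    then show ?thesis using r yz by auto
  qed
qed

text \<open>At a point whose level lies in \<open>S\<close> but not in \<open>T\<close>, the shifted
  weights differ by \<open>2n\<close> modulo \<open>4n\<close>, so the colours differ by
  \<open>n\<close>.\<close>

lemma colour_eq_imp_subset:
  assumes n: "CARD('n) > 1" and eq: "colour S = colour T"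
  shows "S \<subseteq> T"
proof
  fix k assume k: "k \<in> S"
  show "k \<in> T"
  proof (rule ccontr)
    assume nT: "k \<notin> T"
    let ?n = "CARD('n)"
    define x where "x = (axis (inv h 0) (int k) :: int ^ 'n)"
    \<comment> \<open>As \<open>n > 1\<close>, the labels \<open>0\<close> and \<open>n - 1\<close>
      belong to different coordinates, so moving along the first alone reaches every level.\<close>
    have "inv h 0 \<noteq> inv h (?n - 1)" using h_inv[of 0] h_inv[of "?n - 1"] n by fastforce
    then have lev: "level x = int k" by (simp add: level_def x_def axis_def)
    define q where "q = weight x mod (4 * int ?n)"
    have q: "0 \<le> q" "q < 4 * int ?n" by (simp_all add: q_def)
    have dq: "(4 * int ?n) dvd (weight x - q)" by (simp add: q_def mod_eq_dvd_iff)
    have T: "colour T x = Suc (nat q div 2)"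
      using lev nT dq q by (intro colour_eqI) auto
    \<comment> \<open>The representative of \<open>q + 2n\<close> modulo \<open>4n\<close> between 0
      and \<open>4n - 1\<close>.\<close>
    define r where "r = (if q < 2 * int ?n then q + 2 * int ?n else q - 2 * int ?n)"
    have "weight x + 2 * int ?n - r = weight x - q \<or>
        weight x + 2 * int ?n - r = weight x - q + 4 * int ?n"
      by (auto simp: r_def)
    then have "(4 * int ?n) dvd (weight x + 2 * int ?n - r)"
      using dq by (metis dvd_add dvd_refl)
    then have "colour S x = Suc (nat r div 2)"
      using lev k q by (intro colour_eqI) (auto simp: r_def)
    with T eq have "nat r div 2 = nat q div 2" by simp
    then show False using q n unfolding r_def by (auto split: if_splits)
  qed
qed

end

section \<open>Counting partitions and isomorphism classes\<close>

lemma lepoll_biased_partitions: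
  assumes "CARD('n::finite) > 1"
  shows "(UNIV :: nat set set) \<lesssim> (biased_partitions :: (nat \<Rightarrow> (int ^ 'n) set) set)"
proof -
  let ?I = "part_index TYPE('n)"
  obtain h :: "'n \<Rightarrow> nat" where h: "bij_betw h UNIV {..<CARD('n)}"
    using ex_bij_betw_finite_nat[of "UNIV :: 'n set"] by (auto simp: atLeast0LessThan)
  define P where "P S = (\<lambda>i\<in>?I. {x. colour h S x = i})" for S
  have "P S \<in> biased_partitions" for S
    unfolding P_def biased_partitions_def mem_Collect_eq
    by (rule biased_partition_of_colouring) (auto intro: colour_in_part_index colour_surj_on_nbrs h)
  moreover have "inj P"
  proof (rule injI)
    fix S T assume eq: "P S = P T"
    \<comment> \<open>Each point lies in the part indexed by its colour, so the partition determines
      the colouring.\<close>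
    have "colour h S x = colour h T x" for x
    proof -
      have "x \<in> P S (colour h S x)" using colour_in_part_index[OF h] by (simp add: P_def)
      then show ?thesis unfolding eq using colour_in_part_index[OF h, of S x] by (simp add: P_def)
    qed
    then have "colour h S = colour h T" by blast
    then show "S = T" using colour_eq_imp_subset[OF h assms] by (metis subset_antisym)
  qed
  ultimately show ?thesis unfolding lepoll_def by blast
qed

text \<open>An uncountable set with countable classes has infinitely many of them. Each class is
  then no larger than \<open>A // r\<close>, and a union of that many such classes, which is
  \<open>A\<close>, is no larger either.\<close>

lemma lepoll_quotient_countable_classes:
  assumes r: "equiv A r" and classes: "\<And>x. x \<in> A \<Longrightarrow> countable (r `` {x})"
    and "uncountable A"
  shows "A \<lesssim> A // r"
proof -
  have countable: "countable C" if "C \<in> A // r" for C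
    using that classes by (auto simp: quotient_def)
  have A: "(\<Union>C\<in>A // r. C) = A" using Union_quotient[OF r] by simp
  have "uncountable (A // r)"
    using countable countable_UN[of "A // r" "\<lambda>C. C"] A assms(3) by auto
  then have inf: "infinite (A // r)" using countable_finite by blast
  have "ordLeq3 (card_of C) (card_of (A // r))" if "C \<in> A // r" for C
  proof -
    have "C \<lesssim> (UNIV :: nat set)"
      using countable[OF that] by (auto simp: countable_def lepoll_def)
    also have "(UNIV :: nat set) \<lesssim> A // r"
      using inf by (simp add: infinite_le_lepoll)
    finally show ?thesis by (simp add: card_of_ordLeq lepoll_def)
  qed
  then have "ordLeq3 (card_of (\<Union>C\<in>A // r. C)) (card_of (A // r))"
    using inf by (intro card_of_UNION_ordLeq_infinite) (auto simp: card_of_refl ordIso_imp_ordLeq)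
  then show ?thesis
    unfolding A by (simp add: card_of_ordLeq lepoll_def)
qed

theorem theorem4p2:
  assumes "CARD('n::finite) > 1"
  shows "(biased_partitions :: (nat \<Rightarrow> (int ^ 'n) set) set) // partition_iso
           \<approx> (UNIV :: nat set set)"
proof (rule lepoll_antisym)
  let ?A = "biased_partitions :: (nat \<Rightarrow> (int ^ 'n) set) set"
  have "?A // partition_iso = (\<lambda>X. partition_iso `` {X}) ` ?A"
    by (auto simp: quotient_def)
  then have "?A // partition_iso \<lesssim> ?A" by (simp add: image_lepoll)
  also have "?A \<lesssim> (UNIV :: nat set set)" by (rule biased_partitions_lepoll)
  finally show "?A // partition_iso \<lesssim> (UNIV :: nat set set)" .
  have large: "(UNIV :: nat set set) \<lesssim> ?A" by (rule lepoll_biased_partitions[OF assms])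
  have "uncountable (UNIV :: nat set set)"
    using Cantors_theorem[of "UNIV :: nat set"] by (simp add: uncountable_def)
  then have "uncountable ?A" using large countable_lepoll by blast
  then have "?A \<lesssim> ?A // partition_iso"
    by (intro lepoll_quotient_countable_classes equiv_partition_iso countable_partition_iso_class)
  with large show "(UNIV :: nat set set) \<lesssim> ?A // partition_iso"
    by (rule lepoll_trans)
qed

end
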